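(* Let $m\geq 4$ be an integer. Then the following assertion (Lin's conjecture for $m$ factors) is false: "for every $n\ge 1$, all positive semidefinite $A_1,\ldots,A_m\in M_n$ and all real $p_1,\ldots,p_m>0$ with $\frac1{p_1}+\cdots+\frac1{p_m}=1$, there exists a unitary matrix $U\in M_n$ such that $U|A_1\cdots A_m|U^*\preceq \frac1{p_1}A_1^{p_1}+\cdots+\frac1{p_m}A_m^{p_m}$ (equivalently, $\lambda_j(|A_1\cdots A_m|)\le\lambda_j\left(\frac1{p_1}A_1^{p_1}+\cdots+\frac1{p_m}A_m^{p_m}\right)$ for all $j=1,\ldots,n$)." More precisely, for each integer $m\ge 4$ there are positive semidefinite matrices $A_1,\ldots,A_m\in M_2$ and real exponents $p_1,\ldots,p_m>1$ satisfying \[ \frac1{p_1}+\cdots+\frac1{p_m}=1 \] for which \[ \lambda_1(|A_1\cdots A_m|)>\lambda_1\left(\frac1{p_1}A_1^{p_1}+\cdots+\frac1{p_m}A_m^{p_m}\right). \]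
   Context: $M_n$ denotes the set of $n\times n$ complex matrices. For $X\in M_n$, $|X|=(X^*X)^{1/2}$ is the positive semidefinite square root of $X^*X$. For Hermitian $X,Y$, $X\preceq Y$ means that $Y-X$ is positive semidefinite. For a Hermitian matrix $H\in M_n$, its eigenvalues (with multiplicity) are arranged as $\lambda_1(H)\ge\lambda_2(H)\ge\cdots\ge\lambda_n(H)$. For positive semidefinite $A$ and real $p>0$, $A^p$ is defined by the spectral functional calculus (with $0^p=0$). "Positive semidefinite" includes Hermitian. *)

theory Defs
  imports "Jordan_Normal_Form.Schur_Decomposition" Complex_Main
begin

definition unitary_mat :: "nat \<Rightarrow> complex mat \<Rightarrow> bool" where
  "unitary_mat n U \<longleftrightarrow>
     U \<in> carrier_mat n n \<and> mat_adjoint U * U = 1\<^sub>m n \<and> U * mat_adjoint U = 1\<^sub>m n"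

definition hermitian_mat :: "nat \<Rightarrow> complex mat \<Rightarrow> bool" where
  "hermitian_mat n A \<longleftrightarrow> A \<in> carrier_mat n n \<and> mat_adjoint A = A"

definition psd_mat :: "nat \<Rightarrow> complex mat \<Rightarrow> bool" where
  "psd_mat n A \<longleftrightarrow> hermitian_mat n A \<and> (\<forall>x\<in>carrier_vec n. 0 \<le> Re ((A *\<^sub>v x) \<bullet>c x))"

(* The relation \<le> that the library puts on type mat is entrywise, hence a separate constant. *)
definition loewner_le :: "nat \<Rightarrow> complex mat \<Rightarrow> complex mat \<Rightarrow> bool" where
  "loewner_le n X Y \<longleftrightarrow> hermitian_mat n X \<and> hermitian_mat n Y \<and> psd_mat n (Y - X)"

definition unitary_diagonalization :: "complex mat \<Rightarrow> complex mat \<Rightarrow> (nat \<Rightarrow> real) \<Rightarrow> bool" where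
  "unitary_diagonalization A U d \<longleftrightarrow>
     unitary_mat (dim_row A) U \<and>
     A = U * mat_diag (dim_row A) (\<lambda>i. complex_of_real (d i)) * mat_adjoint U"

(* f(A) = U diag(f(d_1), ..., f(d_n)) U^* whenever A = U diag(d_1, ..., d_n) U^*.  Meaningful for
   Hermitian A: a diagonalization exists by the spectral theorem, and the result does not depend
   on the chosen one (lemma mat_fun_eq below). *)
definition mat_fun :: "(real \<Rightarrow> real) \<Rightarrow> complex mat \<Rightarrow> complex mat" where
  "mat_fun f A = (THE B. \<exists>U d. unitary_diagonalization A U d \<and>
     B = U * mat_diag (dim_row A) (\<lambda>i. complex_of_real (f (d i))) * mat_adjoint U)"

(* 0 powr p = 0 for every real p, so zero eigenvalues stay zero. *)
definition psd_powr :: "complex mat \<Rightarrow> real \<Rightarrow> complex mat" where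
  "psd_powr A p = mat_fun (\<lambda>t. t powr p) A"

definition mat_abs :: "complex mat \<Rightarrow> complex mat" where
  "mat_abs X = psd_powr (mat_adjoint X * X) (1/2)"

(* The j-th largest eigenvalue (j = 1, ..., n) of a Hermitian n x n matrix, counted with
   multiplicity.  The roots of the characteristic polynomial are then real, so Re loses nothing. *)
definition eigval :: "nat \<Rightarrow> complex mat \<Rightarrow> real" where
  "eigval j H = rev (sorted_list_of_multiset (image_mset Re (proots (char_poly H)))) ! (j - 1)"

definition ordered_prod :: "nat \<Rightarrow> nat \<Rightarrow> (nat \<Rightarrow> complex mat) \<Rightarrow> complex mat" where
  "ordered_prod n m A = foldr (*) (map A [1..<Suc m]) (1\<^sub>m n)"

definition young_sum :: "nat \<Rightarrow> nat \<Rightarrow> (nat \<Rightarrow> real) \<Rightarrow> (nat \<Rightarrow> complex mat) \<Rightarrow> complex mat" where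
  "young_sum n m p A =
     foldr (+) (map (\<lambda>i. complex_of_real (1 / p i) \<cdot>\<^sub>m psd_powr (A i) (p i)) [1..<Suc m]) (0\<^sub>m n n)"

definition lin_data :: "nat \<Rightarrow> nat \<Rightarrow> (nat \<Rightarrow> real) \<Rightarrow> (nat \<Rightarrow> complex mat) \<Rightarrow> bool" where
  "lin_data n m p A \<longleftrightarrow>
     (\<forall>i\<in>{1..m}. psd_mat n (A i)) \<and> (\<forall>i\<in>{1..m}. 0 < p i) \<and> (\<Sum>i=1..m. 1 / p i) = 1"

definition lin_unitary :: "nat \<Rightarrow> nat \<Rightarrow> (nat \<Rightarrow> real) \<Rightarrow> (nat \<Rightarrow> complex mat) \<Rightarrow> bool" where
  "lin_unitary n m p A \<longleftrightarrow>
     (\<exists>U. unitary_mat n U \<and>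
        loewner_le n (U * mat_abs (ordered_prod n m A) * mat_adjoint U) (young_sum n m p A))"

definition lin_eigenvalues :: "nat \<Rightarrow> nat \<Rightarrow> (nat \<Rightarrow> real) \<Rightarrow> (nat \<Rightarrow> complex mat) \<Rightarrow> bool" where
  "lin_eigenvalues n m p A \<longleftrightarrow>
     (\<forall>j\<in>{1..n}. eigval j (mat_abs (ordered_prod n m A)) \<le> eigval j (young_sum n m p A))"

definition lin_conjecture :: "nat \<Rightarrow> bool" where
  "lin_conjecture m \<longleftrightarrow> (\<forall>n\<ge>1. \<forall>p A. lin_data n m p A \<longrightarrow> lin_unitary n m p A)"

lemma mat_adjoint_carrier:
  assumes "A \<in> carrier_mat r c"
  shows "mat_adjoint A \<in> carrier_mat c r"
  using assms by (auto simp: mat_adjoint_def mat_of_rows_def)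

lemma mat_fun_diagonal_unique:
  fixes d e :: "nat \<Rightarrow> real" and f :: "real \<Rightarrow> real"
  assumes U: "unitary_mat n U" and V: "unitary_mat n V"
    and eq: "U * mat_diag n (\<lambda>i. complex_of_real (d i)) * mat_adjoint U =
             V * mat_diag n (\<lambda>i. complex_of_real (e i)) * mat_adjoint V"
  shows "U * mat_diag n (\<lambda>i. complex_of_real (f (d i))) * mat_adjoint U =
         V * mat_diag n (\<lambda>i. complex_of_real (f (e i))) * mat_adjoint V"
proof -
  let ?D = "\<lambda>g. mat_diag n (\<lambda>i. complex_of_real (g i))"
  let ?U' = "mat_adjoint U" and ?V' = "mat_adjoint V"
  define W where "W = ?V' * U"
  have carr: "U \<in> carrier_mat n n" "V \<in> carrier_mat n n"
    using U V by (auto simp: unitary_mat_def)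
  have carr': "?U' \<in> carrier_mat n n" "?V' \<in> carrier_mat n n"
    using carr by (simp_all add: mat_adjoint_carrier)
  have W: "W \<in> carrier_mat n n" using carr carr' by (simp add: W_def)
  have D: "\<And>g. ?D g \<in> carrier_mat n n" by simp
  have DW: "\<And>g. ?D g * W \<in> carrier_mat n n" by (rule mult_carrier_mat[OF D W])
  have UU: "?U' * U = 1\<^sub>m n" "U * ?U' = 1\<^sub>m n" and VV: "?V' * V = 1\<^sub>m n" "V * ?V' = 1\<^sub>m n"
    using U V by (auto simp: unitary_mat_def)
  have assoc: "\<And>X Y Z :: complex mat. X \<in> carrier_mat n n \<Longrightarrow> Y \<in> carrier_mat n n \<Longrightarrow>
      Z \<in> carrier_mat n n \<Longrightarrow> X * Y * Z = X * (Y * Z)"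
    by (rule assoc_mult_mat)
  have VW: "V * W = U"
  proof -
    have "V * W = (V * ?V') * U" using assoc[OF carr(2) carr'(2) carr(1)] by (simp add: W_def)
    also have "\<dots> = U" using VV(2) carr by simp
    finally show ?thesis .
  qed
  have WU: "W * ?U' = ?V'"
  proof -
    have "W * ?U' = ?V' * (U * ?U')" using assoc[OF carr'(2) carr(1) carr'(1)] by (simp add: W_def)
    also have "\<dots> = ?V'" using UU(2) carr' by simp
    finally show ?thesis .
  qed
  have "W * ?D d = ?V' * (U * ?D d)"
    using assoc[OF carr'(2) carr(1) D] by (simp add: W_def)
  also have "U * ?D d = (U * ?D d) * (?U' * U)"
    unfolding UU(1) by (rule right_mult_one_mat[symmetric, of _ n n]) (use carr D in simp)
  also have "\<dots> = (U * ?D d * ?U') * U"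
    by (rule assoc_mult_mat[symmetric, of _ n n _ n _ n]) (use carr carr' D in simp_all)
  also have "\<dots> = (V * ?D e * ?V') * U" by (simp only: eq)
  also have "\<dots> = V * (?D e * W)"
    using assoc[of "V * ?D e" ?V' U] assoc[of V "?D e" W] carr carr' D W
    by (simp add: W_def)
  also have "?V' * (V * (?D e * W)) = (?V' * V) * (?D e * W)"
    by (rule assoc_mult_mat[symmetric, of _ n n _ n _ n]) (use carr carr' DW in simp_all)
  also have "\<dots> = ?D e * W" unfolding VV(1) by (rule left_mult_one_mat[OF DW])
  finally have com: "W * ?D d = ?D e * W" .
  have "W * ?D (\<lambda>i. f (d i)) = ?D (\<lambda>i. f (e i)) * W"
  proof (rule eq_matI)
    fix i j assume "i < dim_row (?D (\<lambda>i. f (e i)) * W)" "j < dim_col (?D (\<lambda>i. f (e i)) * W)"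
    then have ij: "i < n" "j < n" using W by (auto simp: mat_diag_def)
    have "(W * ?D d) $$ (i, j) = (?D e * W) $$ (i, j)" by (simp only: com)
    then have "W $$ (i, j) * complex_of_real (d j) = complex_of_real (e i) * W $$ (i, j)"
      using ij by (simp add: mat_diag_mult_left[OF W] mat_diag_mult_right[OF W])
    then have "W $$ (i, j) = 0 \<or> d j = e i" by (auto simp: mult.commute)
    then show "(W * ?D (\<lambda>i. f (d i))) $$ (i, j) = (?D (\<lambda>i. f (e i)) * W) $$ (i, j)"
      using ij by (auto simp: mat_diag_mult_left[OF W] mat_diag_mult_right[OF W])
  qed (use W in \<open>simp_all add: mat_diag_def\<close>)
  note comf = this
  have "U * ?D (\<lambda>i. f (d i)) * ?U' = (V * W) * ?D (\<lambda>i. f (d i)) * ?U'" by (simp only: VW)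
  also have "\<dots> = V * (W * ?D (\<lambda>i. f (d i))) * ?U'" using assoc[OF carr(2) W D] by simp
  also have "\<dots> = V * (?D (\<lambda>i. f (e i)) * W) * ?U'" by (simp only: comf)
  also have "\<dots> = V * ?D (\<lambda>i. f (e i)) * (W * ?U')"
    using assoc[OF carr(2) D W] assoc[of "V * ?D (\<lambda>i. f (e i))" W ?U'] carr carr' D W by simp
  finally show ?thesis by (simp only: WU)
qed

lemma mat_fun_eq:
  assumes "unitary_diagonalization A U d"
  shows "mat_fun f A =
    U * mat_diag (dim_row A) (\<lambda>i. complex_of_real (f (d i))) * mat_adjoint U"
  unfolding mat_fun_def
proof (rule the_equality)
  show "\<exists>V e. unitary_diagonalization A V e \<and>
      U * mat_diag (dim_row A) (\<lambda>i. complex_of_real (f (d i))) * mat_adjoint U =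
      V * mat_diag (dim_row A) (\<lambda>i. complex_of_real (f (e i))) * mat_adjoint V"
    using assms by blast
next
  fix B
  assume "\<exists>V e. unitary_diagonalization A V e \<and>
      B = V * mat_diag (dim_row A) (\<lambda>i. complex_of_real (f (e i))) * mat_adjoint V"
  then obtain V e where V: "unitary_diagonalization A V e"
    and B: "B = V * mat_diag (dim_row A) (\<lambda>i. complex_of_real (f (e i))) * mat_adjoint V"
    by blast
  show "B = U * mat_diag (dim_row A) (\<lambda>i. complex_of_real (f (d i))) * mat_adjoint U"
    unfolding B
    by (rule mat_fun_diagonal_unique)
      (use assms V in \<open>auto simp: unitary_diagonalization_def\<close>)
qed

end

theory Submission
  imports Defs "Jordan_Normal_Form.Spectral_Radius"
begin

text \<open>Orthogonal projections are fixed by all powers \<open>A\<^sup>p\<close>, so for rank-one projections onto lines at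
  angles \<open>\<theta>\<^sub>1, \<dots>, \<theta>\<^sub>m\<close> the left-hand side is the product of the cosines of consecutive angle
  differences, while the right-hand side is a convex combination of the projections in which the
  weights are free. Four lines at angles \<open>0, \<theta>, 2\<theta>, 3\<theta>\<close> have product \<open>cos\<^sup>3 \<theta>\<close>, whereas putting
  almost all weight on the two outer ones brings the largest eigenvalue of the combination down to
  almost \<open>cos\<^sup>2 (3\<theta>/2)\<close>, which is smaller. A rational version uses the unit vectors \<open>(1, 0)\<close>,
  \<open>(4/5, 3/5)\<close>, \<open>(3/5, 4/5)\<close>, \<open>(0, 1)\<close> with weights \<open>7/16, 1/16, 1/16, 7/16\<close>: the two sides are
  \<open>384/625\<close> and \<open>14/25 = 350/625\<close>. Repeating the last projection and splitting its weight gives every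
  larger \<open>m\<close>. The equivalence of the unitary and the eigenvalue form of the conjecture is Weyl
  monotonicity in one direction and matching of ordered eigenbases in the other.\<close>

subsection \<open>Adjoints, unitary matrices and the spectral theorem\<close>

lemma mat_adjoint_dim [simp]:
  "dim_row (mat_adjoint A) = dim_col A" "dim_col (mat_adjoint A) = dim_row A"
  by (auto simp: mat_adjoint_def mat_of_rows_def)

lemma mat_adjoint_index [simp]:
  assumes "i < dim_col A" "j < dim_row A"
  shows "mat_adjoint A $$ (i, j) = conjugate (A $$ (j, i))"
  using assms by (auto simp: mat_adjoint_def mat_of_rows_def)

lemma mat_adjoint_adjoint [simp]:
  "mat_adjoint (mat_adjoint A) = (A :: 'a :: conjugatable_field mat)"
  by (rule eq_matI) auto

lemma mat_adjoint_mult: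
  fixes A B :: "'a :: conjugatable_field mat"
  assumes "dim_col A = dim_row B"
  shows "mat_adjoint (A * B) = mat_adjoint B * mat_adjoint A"
  by (rule eq_matI)
    (use assms in \<open>auto simp: scalar_prod_def sum_conjugate conjugate_dist_mul mult.commute\<close>)

lemma mat_adjoint_add:
  fixes A B :: "'a :: conjugatable_field mat"
  assumes "A \<in> carrier_mat r c" "B \<in> carrier_mat r c"
  shows "mat_adjoint (A + B) = mat_adjoint A + mat_adjoint B"
  by (rule eq_matI) (use assms in \<open>auto simp: conjugate_dist_add\<close>)

lemma mat_adjoint_one [simp]: "mat_adjoint (1\<^sub>m n) = (1\<^sub>m n :: complex mat)"
  by (rule eq_matI) auto

lemma mat_adjoint_diag_real [simp]:
  "mat_adjoint (mat_diag n (\<lambda>i. complex_of_real (d i))) = mat_diag n (\<lambda>i. complex_of_real (d i))"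
  by (rule eq_matI) (auto simp: mat_diag_def)

lemma scalar_prod_mat_adjoint:
  fixes A :: "'a :: conjugatable_field mat"
  assumes A: "A \<in> carrier_mat r c" and x: "x \<in> carrier_vec c" and y: "y \<in> carrier_vec r"
  shows "(A *\<^sub>v x) \<bullet>c y = x \<bullet>c (mat_adjoint A *\<^sub>v y)"
proof -
  have "(A *\<^sub>v x) \<bullet>c y = (\<Sum>i<r. \<Sum>j<c. A $$ (i, j) * x $ j * conjugate (y $ i))"
    using A x y by (auto simp: scalar_prod_def sum_distrib_right atLeast0LessThan intro!: sum.cong)
  also have "\<dots> = (\<Sum>j<c. \<Sum>i<r. A $$ (i, j) * x $ j * conjugate (y $ i))"
    by (rule sum.swap)
  also have "\<dots> = x \<bullet>c (mat_adjoint A *\<^sub>v y)"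
    using A x y
    by (auto simp: scalar_prod_def sum_distrib_left atLeast0LessThan sum_conjugate
        conjugate_dist_mul algebra_simps intro!: sum.cong)
  finally show ?thesis .
qed

text \<open>For square matrices a left inverse is also a right inverse.\<close>

lemma unitary_matI:
  assumes U: "U \<in> carrier_mat n n" and UU: "mat_adjoint U * U = 1\<^sub>m n"
  shows "unitary_mat n U"
  using mat_mult_left_right_inverse[OF mat_adjoint_carrier[OF U] U UU] assms
  by (auto simp: unitary_mat_def)

lemma unitary_matD:
  assumes "unitary_mat n U"
  shows "U \<in> carrier_mat n n" "mat_adjoint U \<in> carrier_mat n n"
    "mat_adjoint U * U = 1\<^sub>m n" "U * mat_adjoint U = 1\<^sub>m n"
  using assms by (auto simp: unitary_mat_def mat_adjoint_carrier)

lemma unitary_mat_adjoint: "unitary_mat n U \<Longrightarrow> unitary_mat n (mat_adjoint U)"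
  by (auto simp: unitary_mat_def mat_adjoint_carrier)

lemma unitary_mat_one: "unitary_mat n (1\<^sub>m n)"
  by (auto simp: unitary_mat_def)

lemma mult_carrier_square:
  "A \<in> carrier_mat n n \<Longrightarrow> B \<in> carrier_mat n n \<Longrightarrow> A * B \<in> carrier_mat n n"
  by (rule mult_carrier_mat)

lemma unitary_cancel:
  assumes U: "unitary_mat n U" and A: "A \<in> carrier_mat n n"
  shows "mat_adjoint U * (U * A) = A" "U * (mat_adjoint U * A) = A"
  using unitary_matD[OF U] A by (simp_all flip: assoc_mult_mat[of _ n n _ n _ n])

lemma unitary_mat_mult:
  assumes U: "unitary_mat n U" and V: "unitary_mat n V"
  shows "unitary_mat n (U * V)"
proof (rule unitary_matI)
  note c = unitary_matD[OF U] unitary_matD[OF V]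
  show "U * V \<in> carrier_mat n n" using c by (simp add: mult_carrier_square)
  have "mat_adjoint (U * V) * (U * V) = mat_adjoint V * (mat_adjoint U * (U * V))"
    using c assoc_mult_mat[of "mat_adjoint V" n n "mat_adjoint U" n "U * V" n]
    by (simp add: mat_adjoint_mult mult_carrier_square)
  also have "\<dots> = 1\<^sub>m n"
    using c unitary_cancel[OF U, of V] by simp
  finally show "mat_adjoint (U * V) * (U * V) = 1\<^sub>m n" .
qed

lemma hermitian_conjugation:
  assumes H: "hermitian_mat n H" and U: "U \<in> carrier_mat n n"
  shows "hermitian_mat n (U * H * mat_adjoint U)"
proof -
  have c: "H \<in> carrier_mat n n" "mat_adjoint U \<in> carrier_mat n n" "mat_adjoint H = H"
    using assms by (auto simp: hermitian_mat_def mat_adjoint_carrier)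
  have "mat_adjoint (U * H * mat_adjoint U) = U * (H * mat_adjoint U)"
    using c U by (simp add: mat_adjoint_mult)
  also have "\<dots> = U * H * mat_adjoint U"
    using c U by simp
  finally show ?thesis
    using c U by (simp add: hermitian_mat_def mult_carrier_square)
qed

lemma hermitian_mat_diag: "hermitian_mat n (mat_diag n (\<lambda>i. complex_of_real (d i)))"
  by (simp add: hermitian_mat_def)

text \<open>Basis completion and Gram-Schmidt give an orthogonal basis beginning with
  \<open>v\<close>; its normalized vectors are the columns of \<open>W\<close>. This starts the
  deflation in the spectral theorem, where only the direction of the first column matters.\<close>

lemma unitary_mat_first_col:
  assumes v: "v \<in> carrier_vec n" and v0: "v \<noteq> 0\<^sub>v n"
  shows "\<exists>W c. unitary_mat n W \<and> col W 0 = c \<cdot>\<^sub>v v"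
proof -
  interpret cof_vec_space n "TYPE(complex)" .
  define b where "b = basis_completion v"
  define ws where "ws = gram_schmidt n b"
  define s where "s i = complex_of_real (1 / sqrt (Re (ws ! i \<bullet>c ws ! i)))" for i
  define W where "W = mat n n (\<lambda>(i, j). s j * ws ! j $ i)"
  have n: "n \<noteq> 0" using v v0 by (cases n) auto
  note bc = basis_completion[OF v v0, folded b_def]
  from gram_schmidt_result[OF bc(2,4) _ refl, folded ws_def] bc
  have ws: "set ws \<subseteq> carrier_vec n" "corthogonal ws" "length ws = n" by auto
  \<comment> \<open>Gram-Schmidt keeps the first vector of the list unchanged.\<close>
  obtain vs where "b = v # vs" using bc n by (cases b) auto
  then have hd: "ws ! 0 = v"
    using gram_schmidt_hd[OF v, of vs] ws(3) n by (metis hd_conv_nth list.size(3) ws_def)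
  have wc: "ws ! i \<in> carrier_vec n" if "i < n" for i using ws that by auto
  have "mat_adjoint W * W = 1\<^sub>m n"
  proof (rule eq_matI)
    fix i j assume "i < dim_row (1\<^sub>m n :: complex mat)" "j < dim_col (1\<^sub>m n :: complex mat)"
    then have ij: "i < n" "j < n" by auto
    have "(mat_adjoint W * W) $$ (i, j) = s j * cnj (s i) * (ws ! j \<bullet>c ws ! i)"
      using ij wc[of i] wc[of j]
      by (auto simp: W_def scalar_prod_def sum_distrib_left algebra_simps intro!: sum.cong)
    also have "\<dots> = 1\<^sub>m n $$ (i, j)"
    proof (cases "i = j")
      case False
      then show ?thesis using corthogonalD[OF ws(2), of j i] ij ws by auto
    next
      case True
      let ?q = "ws ! i \<bullet>c ws ! i"
      have "?q \<noteq> 0" using corthogonalD[OF ws(2), of i i] ij ws by auto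
      \<comment> \<open>In the order on the complex numbers, being nonnegative includes being
        real.\<close>
      moreover have "0 \<le> ?q" by (rule conjugate_square_ge_0_vec)
      ultimately have q: "0 < Re ?q" "?q = complex_of_real (Re ?q)"
        by (auto simp: less_eq_complex_def complex_eq_iff)
      have "s i * cnj (s i) = complex_of_real (1 / Re ?q)"
        using q(1) by (simp add: s_def flip: of_real_mult)
      then have "s i * cnj (s i) * ?q = complex_of_real (1 / Re ?q * Re ?q)"
        using q(2) by (metis of_real_mult)
      then show ?thesis using True ij q(1) by simp
    qed
    finally show "(mat_adjoint W * W) $$ (i, j) = 1\<^sub>m n $$ (i, j)" .
  qed (auto simp: W_def)
  then have "unitary_mat n W" by (intro unitary_matI) (auto simp: W_def)
  moreover have "col W 0 = s 0 \<cdot>\<^sub>v v" using n v hd by (auto simp: W_def)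
  ultimately show ?thesis by blast
qed

lemma four_block_diag_mult:
  fixes A B A' B' :: "'a :: semiring_0 mat"
  assumes "A \<in> carrier_mat m m" "B \<in> carrier_mat k k" "A' \<in> carrier_mat m m" "B' \<in> carrier_mat k k"
  shows "four_block_mat A (0\<^sub>m m k) (0\<^sub>m k m) B * four_block_mat A' (0\<^sub>m m k) (0\<^sub>m k m) B' =
    four_block_mat (A * A') (0\<^sub>m m k) (0\<^sub>m k m) (B * B')"
  by (subst mult_four_block_mat[OF assms(1) zero_carrier_mat zero_carrier_mat assms(2)
        assms(3) zero_carrier_mat zero_carrier_mat assms(4)])
    (use assms in \<open>simp add: mult_carrier_mat[OF assms(1,3)] mult_carrier_mat[OF assms(2,4)]\<close>)

text \<open>Deflation: with an eigenvector as first column of a unitary \<open>W\<close>,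
  conjugation by \<open>W\<close> splits the eigenvalue off as a block of size 1, and the induction
  hypothesis diagonalizes the remaining Hermitian block.\<close>

lemma hermitian_diagonalizable:
  assumes "hermitian_mat n A"
  shows "\<exists>U d. unitary_diagonalization A U d"
  using assms
proof (induction n arbitrary: A)
  case 0
  then show ?case
    by (intro exI[of _ "1\<^sub>m 0"])
      (auto simp: unitary_diagonalization_def hermitian_mat_def unitary_mat_one intro!: eq_matI)
next
  case (Suc k)
  let ?n = "Suc k"
  have A: "A \<in> carrier_mat ?n ?n" using Suc.prems by (simp add: hermitian_mat_def)
  obtain e where "eigenvalue A e"
    using spectrum_non_empty[OF A] by (auto simp: spectrum_def)
  then obtain v where v: "v \<in> carrier_vec ?n" "v \<noteq> 0\<^sub>v ?n" "A *\<^sub>v v = e \<cdot>\<^sub>v v"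
    using A by (auto simp: eigenvalue_def eigenvector_def)
  obtain W c where W: "unitary_mat ?n W" and W0: "col W 0 = c \<cdot>\<^sub>v v"
    using unitary_mat_first_col[OF v(1,2)] by blast
  note Wc = unitary_matD[OF W]
  define B where "B = mat_adjoint W * A * W"
  have B: "hermitian_mat ?n B"
    using hermitian_conjugation[OF Suc.prems Wc(2)] by (simp add: B_def)
  then have Bc: "B \<in> carrier_mat ?n ?n" and Badj: "mat_adjoint B = B"
    by (auto simp: hermitian_mat_def)
  have Bsym: "B $$ (i, j) = cnj (B $$ (j, i))" if "i < ?n" "j < ?n" for i j
    using that Bc mat_adjoint_index[of i B j] by (simp add: Badj)
  \<comment> \<open>The first column of \<open>W\<close> is an eigenvector of \<open>A\<close>, so
    the first basis vector is one of \<open>B\<close>.\<close>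
  have "col B 0 = mat_adjoint W *\<^sub>v (A *\<^sub>v col W 0)"
    unfolding B_def assoc_mult_mat[OF Wc(2) A Wc(1)]
    using col_mult2[OF Wc(2) mult_carrier_square[OF A Wc(1)], of 0] col_mult2[OF A Wc(1), of 0]
    by (metis zero_less_Suc)
  also have "A *\<^sub>v col W 0 = e \<cdot>\<^sub>v col W 0"
    using v by (simp add: W0 mult_mat_vec[OF A] smult_smult_assoc mult.commute)
  also have "mat_adjoint W *\<^sub>v (e \<cdot>\<^sub>v col W 0) = e \<cdot>\<^sub>v col (mat_adjoint W * W) 0"
    using Wc mult_mat_vec[OF Wc(2), of "col W 0" e] col_mult2[OF Wc(2,1), of 0] by (simp add: v W0)
  finally have B0: "col B 0 = e \<cdot>\<^sub>v unit_vec ?n 0" by (simp add: Wc)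
  have Bcol: "B $$ (i, 0) = (if i = 0 then e else 0)" if "i < ?n" for i
  proof -
    have "B $$ (i, 0) = col B 0 $ i" using that Bc by simp
    then show ?thesis using that by (simp add: B0)
  qed
  \<comment> \<open>Hermitian symmetry carries the zeros of the first column over to the first row,
    and below makes the diagonal entry \<open>e\<close> real.\<close>
  have Brow: "B $$ (0, i) = (if i = 0 then e else 0)" if "i < ?n" for i
    using Bsym[of 0 i] Bcol[of i] Bcol[of 0] that by (auto split: if_splits)
  have ereal: "e = complex_of_real (Re e)"
    using Bsym[of 0 0] Bcol[of 0] by (auto simp: complex_eq_iff)
  define A' where "A' = mat k k (\<lambda>(i, j). B $$ (Suc i, Suc j))"
  have "hermitian_mat k A'"
    unfolding hermitian_mat_def
    by (auto simp: A'_def intro!: eq_matI Bsym[symmetric])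
  from Suc.IH[OF this] obtain V d where V: "unitary_mat k V"
    and A': "A' = V * mat_diag k (\<lambda>i. complex_of_real (d i)) * mat_adjoint V"
    by (auto simp: unitary_diagonalization_def A'_def)
  note Vc = unitary_matD[OF V]
  \<comment> \<open>\<open>T\<close> is the direct sum of 1 and \<open>V\<close>; accordingly
    \<open>d'\<close> puts \<open>Re e\<close> in front of \<open>d\<close>.\<close>
  define T where "T = four_block_mat (1\<^sub>m 1) (0\<^sub>m 1 k) (0\<^sub>m k 1) V"
  define d' where "d' i = (case i of 0 \<Rightarrow> Re e | Suc j \<Rightarrow> d j)" for i
  let ?D = "mat_diag ?n (\<lambda>i. complex_of_real (d' i))"
  have Tadj: "mat_adjoint T = four_block_mat (1\<^sub>m 1) (0\<^sub>m 1 k) (0\<^sub>m k 1) (mat_adjoint V)"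
    by (rule eq_matI) (use Vc in \<open>auto simp: T_def\<close>)
  have Tc: "T \<in> carrier_mat ?n ?n"
    using four_block_carrier_mat[OF one_carrier_mat[of 1] Vc(1)] by (simp add: T_def)
  have "mat_adjoint T * T = four_block_mat (1\<^sub>m 1) (0\<^sub>m 1 k) (0\<^sub>m k 1) (1\<^sub>m k)"
    unfolding Tadj unfolding T_def
    by (subst four_block_diag_mult[OF one_carrier_mat Vc(2) one_carrier_mat Vc(1)]) (simp add: Vc)
  then have T: "unitary_mat ?n T"
    using Tc by (intro unitary_matI) auto
  have D: "?D = four_block_mat (mat 1 1 (\<lambda>_. e)) (0\<^sub>m 1 k) (0\<^sub>m k 1)
      (mat_diag k (\<lambda>i. complex_of_real (d i)))"
    by (rule eq_matI) (use ereal[symmetric] in \<open>auto simp: mat_diag_def d'_def split: nat.splits\<close>)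
  have Bblock: "B = four_block_mat (mat 1 1 (\<lambda>_. e)) (0\<^sub>m 1 k) (0\<^sub>m k 1) A'"
    by (rule eq_matI) (use Bc Bcol Brow in \<open>auto simp: A'_def\<close>)
  have Dc: "V * mat_diag k (\<lambda>i. complex_of_real (d i)) \<in> carrier_mat k k"
    using Vc by (simp add: mult_carrier_square)
  have TD: "T * ?D = four_block_mat (mat 1 1 (\<lambda>_. e)) (0\<^sub>m 1 k) (0\<^sub>m k 1)
      (V * mat_diag k (\<lambda>i. complex_of_real (d i)))"
    unfolding D unfolding T_def
    by (subst four_block_diag_mult[OF one_carrier_mat Vc(1) _ mat_diag_dim]) simp_all
  have TDT: "T * ?D * mat_adjoint T = B"
    unfolding TD Tadj Bblock A'
    by (subst four_block_diag_mult[OF _ Dc one_carrier_mat Vc(2)]) simp_all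
  have Tac: "mat_adjoint T \<in> carrier_mat ?n ?n" using Tc by (rule mat_adjoint_carrier)
  have Dc': "?D \<in> carrier_mat ?n ?n" by simp
  \<comment> \<open>The two conjugations are undone in turn: the one by \<open>T\<close> gives
    \<open>B\<close>, the one by \<open>W\<close> gives \<open>A\<close>.\<close>
  have "W * T * ?D * mat_adjoint (W * T) = W * (T * ?D * mat_adjoint T) * mat_adjoint W"
    using Wc Tc Tac Dc'
    by (simp add: mat_adjoint_mult assoc_mult_mat[of _ ?n ?n _ ?n _ ?n] mult_carrier_square del: mat_diag_dim)
  also have "\<dots> = (W * (mat_adjoint W * (A * W))) * mat_adjoint W"
    unfolding TDT B_def using A Wc by (simp add: assoc_mult_mat[of _ ?n ?n _ ?n _ ?n])
  also have "\<dots> = A * (W * mat_adjoint W)"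
    using A Wc by (simp only: unitary_cancel[OF W] mult_carrier_square assoc_mult_mat[of _ ?n ?n _ ?n _ ?n])
  also have "\<dots> = A" using A Wc by simp
  finally have "unitary_diagonalization A (W * T) d'"
    using A unitary_mat_mult[OF W T] by (auto simp: unitary_diagonalization_def)
  then show ?case by blast
qed

subsection \<open>Quadratic forms and ordered eigenvalues\<close>

lemma mat_diag_mult_vec:
  assumes "x \<in> carrier_vec n"
  shows "mat_diag n f *\<^sub>v x = vec n (\<lambda>i. f i * x $ i)"
proof (rule eq_vecI)
  fix i assume "i < dim_vec (vec n (\<lambda>i. f i * x $ i))"
  then have i: "i < n" by simp
  have "(mat_diag n f *\<^sub>v x) $ i = (\<Sum>j\<in>{0..<n}. if j = i then f i * x $ i else 0)"
    using i assms by (simp add: mat_diag_def scalar_prod_def if_distribR if_distrib[of "\<lambda>c. c * _"] cong: if_cong)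
  then show "(mat_diag n f *\<^sub>v x) $ i = vec n (\<lambda>i. f i * x $ i) $ i" using i by simp
qed (simp add: mat_diag_def)

text \<open>The form is diagonal in the coordinates of \<open>x\<close> with respect to the columns
  of \<open>U\<close>. Stated over the complex numbers, the equation also records that the form is
  real.\<close>

lemma diagonal_quadratic_form:
  assumes U: "unitary_mat n U" and x: "x \<in> carrier_vec n"
  shows "((U * mat_diag n (\<lambda>i. complex_of_real (d i)) * mat_adjoint U) *\<^sub>v x) \<bullet>c x =
    complex_of_real (\<Sum>i<n. d i * (cmod ((mat_adjoint U *\<^sub>v x) $ i))\<^sup>2)"
proof -
  let ?D = "mat_diag n (\<lambda>i. complex_of_real (d i))"
  define y where "y = mat_adjoint U *\<^sub>v x"
  note c = unitary_matD[OF U]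
  have y: "y \<in> carrier_vec n" using c x by (auto simp: y_def)
  have D: "?D *\<^sub>v y \<in> carrier_vec n" by (rule mult_mat_vec_carrier[OF mat_diag_dim y])
  have "(U * ?D * mat_adjoint U) *\<^sub>v x = U *\<^sub>v (?D *\<^sub>v y)"
    using assoc_mult_mat_vec[of "U * ?D" n n "mat_adjoint U" n x]
      assoc_mult_mat_vec[OF c(1) mat_diag_dim y] c x
    by (simp add: y_def mult_carrier_square)
  then have "((U * ?D * mat_adjoint U) *\<^sub>v x) \<bullet>c x = (?D *\<^sub>v y) \<bullet>c y"
    using scalar_prod_mat_adjoint[OF c(1) D x] by (simp add: y_def)
  also have "\<dots> = (\<Sum>i<n. complex_of_real (d i) * (y $ i * cnj (y $ i)))"
    using y by (simp add: mat_diag_mult_vec[OF y] scalar_prod_def atLeast0LessThan mult.assoc)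
  also have "\<dots> = complex_of_real (\<Sum>i<n. d i * (cmod (y $ i))\<^sup>2)"
    by (simp flip: complex_norm_square)
  finally show ?thesis by (simp add: y_def)
qed

text \<open>This is \<open>diagonal_quadratic_form\<close> with all eigenvalues 1, when the matrix
  is the identity.\<close>

lemma unitary_norm_preserving:
  assumes U: "unitary_mat n U" and x: "x \<in> carrier_vec n"
  shows "(\<Sum>i<n. (cmod ((mat_adjoint U *\<^sub>v x) $ i))\<^sup>2) = Re (x \<bullet>c x)"
  using diagonal_quadratic_form[OF U x, of "\<lambda>_. 1"] unitary_matD[OF U] x
  by (simp flip: of_real_sum)

lemma psd_mat_diagonal_iff:
  assumes U: "unitary_mat n U"
  shows "psd_mat n (U * mat_diag n (\<lambda>i. complex_of_real (d i)) * mat_adjoint U) \<longleftrightarrow>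
    (\<forall>i<n. 0 \<le> d i)" (is "psd_mat n ?A \<longleftrightarrow> _")
proof
  note c = unitary_matD[OF U]
  assume psd: "psd_mat n ?A"
  show "\<forall>i<n. 0 \<le> d i"
  proof (intro allI impI)
    fix i assume i: "i < n"
    \<comment> \<open>Column \<open>i\<close> of \<open>U\<close> is a unit eigenvector to
      \<open>d i\<close>, so the form takes the value \<open>d i\<close> there.\<close>
    let ?x = "U *\<^sub>v unit_vec n i"
    have x: "?x \<in> carrier_vec n" using c by auto
    have "mat_adjoint U *\<^sub>v ?x = unit_vec n i"
      using assoc_mult_mat_vec[OF c(2,1), of "unit_vec n i"] c by simp
    then have "Re ((?A *\<^sub>v ?x) \<bullet>c ?x) = (\<Sum>j<n. d j * (cmod (unit_vec n i $ j))\<^sup>2)"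
      using diagonal_quadratic_form[OF U x, of d] by simp
    also have "\<dots> = (\<Sum>j<n. if j = i then d i else 0)"
      using i by (intro sum.cong) auto
    also have "\<dots> = d i" using i by simp
    finally show "0 \<le> d i" using psd x by (auto simp: psd_mat_def)
  qed
next
  assume "\<forall>i<n. 0 \<le> d i"
  then show "psd_mat n ?A"
    using hermitian_conjugation[OF hermitian_mat_diag unitary_matD(1)[OF U]]
    by (auto simp: psd_mat_def diagonal_quadratic_form[OF U] simp del: of_real_sum intro!: sum_nonneg)
qed

text \<open>As sums over the eigenvalues, the entries can be reindexed by a permutation and
  subtracted termwise.\<close>

lemma unitary_diagonal_index:
  assumes "U \<in> carrier_mat n n" "i < n" "k < n"
  shows "(U * mat_diag n f * mat_adjoint U) $$ (i, k) =
    (\<Sum>j<n. U $$ (i, j) * f j * conjugate (U $$ (k, j)))"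
  using assms by (simp add: mat_diag_mult_right[of U n n] scalar_prod_def atLeast0LessThan)

text \<open>Any diagonalization becomes an ordered one when the same permutation is applied to the
  eigenvalues and to the columns of \<open>U\<close>.\<close>

lemma hermitian_sorted_diagonalization:
  assumes A: "hermitian_mat n A"
  shows "\<exists>U d. unitary_diagonalization A U d \<and> (\<forall>i j. i \<le> j \<longrightarrow> j < n \<longrightarrow> d j \<le> d i)"
proof -
  obtain U d where Ud: "unitary_diagonalization A U d"
    using hermitian_diagonalizable[OF A] by blast
  have n: "dim_row A = n" using A by (auto simp: hermitian_mat_def)
  have U: "unitary_mat n U"
    and Aeq: "A = U * mat_diag n (\<lambda>i. complex_of_real (d i)) * mat_adjoint U"
    using Ud by (auto simp: unitary_diagonalization_def n)
  note c = unitary_matD[OF U]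
  let ?ds = "map d [0..<n]"
  \<comment> \<open>A list and its decreasing rearrangement have the same multiset, which provides
    the permutation \<pi>.\<close>
  have "mset (rev (sort ?ds)) = mset ?ds" by simp
  then obtain \<pi> where \<pi>: "\<pi> permutes {..<n}" and perm: "permute_list \<pi> ?ds = rev (sort ?ds)"
    by (metis mset_eq_permutation length_map length_upt diff_zero)
  have \<pi>n: "\<pi> i < n" if "i < n" for i using permutes_in_image[OF \<pi>, of i] that by simp
  have inj: "\<pi> i = \<pi> j \<longleftrightarrow> i = j" for i j using permutes_inj[OF \<pi>] by (auto dest: injD)
  have nth: "d (\<pi> i) = rev (sort ?ds) ! i" if "i < n" for i
    using permute_list_nth[of \<pi> ?ds i] \<pi> that \<pi>n by (simp add: perm)
  have sorted: "d (\<pi> j) \<le> d (\<pi> i)" if "i \<le> j" "j < n" for i j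
    using that by (simp add: nth rev_nth sorted_nth_mono)
  define V where "V = mat n n (\<lambda>(i, j). U $$ (i, \<pi> j))"
  have V: "V \<in> carrier_mat n n" by (simp add: V_def)
  have "mat_adjoint V * V = 1\<^sub>m n"
  proof (rule eq_matI)
    fix i j assume "i < dim_row (1\<^sub>m n :: complex mat)" "j < dim_col (1\<^sub>m n :: complex mat)"
    then have ij: "i < n" "j < n" by auto
    have "(mat_adjoint V * V) $$ (i, j) = (mat_adjoint U * U) $$ (\<pi> i, \<pi> j)"
      using ij \<pi>n c(1) by (auto simp: V_def scalar_prod_def)
    then show "(mat_adjoint V * V) $$ (i, j) = 1\<^sub>m n $$ (i, j)"
      using ij \<pi>n inj by (simp add: c)
  qed (auto simp: V_def)
  then have "unitary_mat n V" using V by (rule unitary_matI[rotated])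
  moreover have "A = V * mat_diag n (\<lambda>i. complex_of_real (d (\<pi> i))) * mat_adjoint V" (is "_ = ?B")
  proof (rule eq_matI)
    fix i k assume "i < dim_row ?B" "k < dim_col ?B"
    then have ik: "i < n" "k < n" by (auto simp: V_def)
    have "A $$ (i, k) = (\<Sum>j<n. U $$ (i, j) * complex_of_real (d j) * conjugate (U $$ (k, j)))"
      unfolding Aeq by (rule unitary_diagonal_index[OF c(1) ik])
    also have "\<dots> = (\<Sum>j<n. U $$ (i, \<pi> j) * complex_of_real (d (\<pi> j)) * conjugate (U $$ (k, \<pi> j)))"
      by (subst sum.permute[OF \<pi>]) (simp add: o_def)
    also have "\<dots> = ?B $$ (i, k)"
      unfolding unitary_diagonal_index[OF V ik] using ik \<pi>n by (simp add: V_def)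
    finally show "A $$ (i, k) = ?B $$ (i, k)" .
  qed (use n A in \<open>auto simp: V_def hermitian_mat_def\<close>)
  ultimately have "unitary_diagonalization A V (\<lambda>i. d (\<pi> i))"
    unfolding unitary_diagonalization_def n by blast
  then show ?thesis using sorted by blast
qed

text \<open>Similar matrices share their characteristic polynomial, so its roots with multiplicity
  are the diagonal entries. \<open>eigval\<close> counts from 1 and \<open>d\<close> from 0.\<close>

lemma eigval_sorted_diagonalization:
  assumes A: "A \<in> carrier_mat n n" and Ud: "unitary_diagonalization A U d"
    and sorted: "\<And>i j. i \<le> j \<Longrightarrow> j < n \<Longrightarrow> d j \<le> d i" and j: "j \<in> {1..n}"
  shows "eigval j A = d (j - 1)"
proof -
  let ?D = "mat_diag n (\<lambda>i. complex_of_real (d i))"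
  have U: "unitary_mat n U" and Aeq: "A = U * ?D * mat_adjoint U"
    using Ud A by (auto simp: unitary_diagonalization_def)
  note c = unitary_matD[OF U]
  have "similar_mat_wit A ?D U (mat_adjoint U)"
    by (rule similar_mat_witI[of _ _ n]) (use c A Aeq in auto)
  then have "char_poly A = char_poly ?D"
    by (intro char_poly_similar) (auto simp: similar_mat_def)
  also have "\<dots> = (\<Prod>a\<leftarrow>diag_mat ?D. [:- a, 1:])"
    by (rule char_poly_upper_triangular[OF mat_diag_dim]) (auto simp: mat_diag_def)
  also have "diag_mat ?D = map (\<lambda>i. complex_of_real (d i)) [0..<n]"
    by (auto simp: diag_mat_def mat_diag_def)
  finally have cp: "char_poly A = (\<Prod>i\<leftarrow>[0..<n]. [:- complex_of_real (d i), 1:])"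
    by (simp add: o_def)
  have "proots (char_poly A) = mset (map (\<lambda>i. complex_of_real (d i)) [0..<n])"
    unfolding cp
  proof (induction n)
    case (Suc n)
    have "(\<Prod>i\<leftarrow>[0..<n]. [:- complex_of_real (d i), 1:]) \<noteq> 0"
      by (auto simp: prod_list_zero_iff)
    then show ?case using Suc by (simp add: proots_mult del: mult_pCons_right)
  qed simp
  then have "image_mset Re (proots (char_poly A)) = mset (map d [0..<n])"
    by (simp add: multiset.map_comp o_def flip: mset_map)
  then have "eigval j A = rev (sort (map d [0..<n])) ! (j - 1)"
    by (simp only: eigval_def sorted_list_of_multiset_mset)
  \<comment> \<open>As \<open>d\<close> decreases, sorting reverses the list, and the
    \<open>rev\<close> in \<open>eigval\<close> restores it.\<close>
  also have "sort (map d [0..<n]) = rev (map d [0..<n])"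
  proof (rule properties_for_sort)
    show "sorted (rev (map d [0..<n]))"
      unfolding sorted_rev_iff_nth_mono using sorted by auto
  qed simp
  finally show ?thesis using j by auto
qed

text \<open>Courant-Fischer dimension count: the span of the eigenvectors of \<open>X\<close> to its first \<open>j + 1\<close>
  eigenvalues meets the orthogonal complement of the first \<open>j\<close> eigenvectors of \<open>Y\<close>.\<close>

lemma weyl_monotonicity:
  fixes n :: nat and x y :: "nat \<Rightarrow> real"
  defines "D \<equiv> \<lambda>z. mat_diag n (\<lambda>i. complex_of_real (z i))"
  assumes U: "unitary_mat n U" and V: "unitary_mat n V"
    and psd: "psd_mat n (V * D y * mat_adjoint V - U * D x * mat_adjoint U)"
    and x: "\<And>i j. i \<le> j \<Longrightarrow> j < n \<Longrightarrow> x j \<le> x i"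
    and y: "\<And>i j. i \<le> j \<Longrightarrow> j < n \<Longrightarrow> y j \<le> y i"
    and j: "j < n"
  shows "x j \<le> y j"
proof -
  note c = unitary_matD[OF U] unitary_matD[OF V]
  define M where "M = mat_adjoint V * U"
  \<comment> \<open>\<open>N\<close> encodes \<open>j\<close> linear conditions on
    \<open>j + 1\<close> unknowns. A zero row makes it square, so that its vanishing determinant
    yields a nonzero solution \<open>a\<close>.\<close>
  define N where "N = mat (Suc j) (Suc j) (\<lambda>(i, l). if i < j then M $$ (i, l) else 0)"
  have M: "M \<in> carrier_mat n n" using c by (simp add: M_def mult_carrier_square)
  have N: "N \<in> carrier_mat (Suc j) (Suc j)" by (simp add: N_def)
  have "transpose_mat N *\<^sub>v unit_vec (Suc j) j = 0\<^sub>v (Suc j)"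
    by (rule eq_vecI) (auto simp: N_def scalar_prod_def intro!: sum.neutral)
  moreover have "unit_vec (Suc j) j \<noteq> (0\<^sub>v (Suc j) :: complex vec)"
    by (auto dest!: arg_cong[where f = "\<lambda>v. v $ j"])
  ultimately have "det (transpose_mat N) = 0"
    using N by (subst det_0_iff_vec_prod_zero[of _ "Suc j"]) (auto intro!: exI[of _ "unit_vec (Suc j) j"])
  then have "det N = 0" using det_transpose[OF N] by simp
  then obtain a where a: "a \<in> carrier_vec (Suc j)" "a \<noteq> 0\<^sub>v (Suc j)" "N *\<^sub>v a = 0\<^sub>v (Suc j)"
    using det_0_iff_vec_prod_zero[OF N] by blast
  \<comment> \<open>Padded with zeros, \<open>a\<close> becomes the coordinate vector of some
    \<open>w\<close> in the span of the first \<open>j + 1\<close> columns of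
    \<open>U\<close>.\<close>
  define a' where "a' = vec n (\<lambda>i. if i \<le> j then a $ i else 0)"
  have a': "a' \<in> carrier_vec n" by (simp add: a'_def)
  have a'0: "a' $ i = 0" if "i < n" "\<not> i \<le> j" for i using that by (simp add: a'_def)
  define w where "w = U *\<^sub>v a'"
  have w: "w \<in> carrier_vec n" using c a' by (auto simp: w_def)
  have Uw: "mat_adjoint U *\<^sub>v w = a'"
    using assoc_mult_mat_vec[OF c(2,1) a'] c a' by (simp add: w_def)
  define b where "b = mat_adjoint V *\<^sub>v w"
  have b: "b = M *\<^sub>v a'"
    using assoc_mult_mat_vec[OF c(6,1) a'] by (simp add: b_def w_def M_def)
  \<comment> \<open>The conditions in \<open>N\<close> say that \<open>w\<close> is orthogonal to
    the first \<open>j\<close> columns of \<open>V\<close>.\<close>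
  have b0: "b $ i = 0" if "i < j" for i
  proof -
    have "b $ i = (\<Sum>l<n. M $$ (i, l) * a' $ l)"
      using that j M a' by (simp add: b scalar_prod_def atLeast0LessThan)
    also have "\<dots> = (\<Sum>l<Suc j. M $$ (i, l) * a $ l)"
      using j by (intro sum.mono_neutral_cong_right) (auto simp: a'_def)
    also have "\<dots> = (N *\<^sub>v a) $ i"
      using that a(1) by (simp add: N_def scalar_prod_def atLeast0LessThan)
    finally show ?thesis using that a(3) by simp
  qed
  define S where "S = Re (w \<bullet>c w)"
  have Sa: "S = (\<Sum>i<n. (cmod (a' $ i))\<^sup>2)"
    using unitary_norm_preserving[OF U w] by (simp add: S_def Uw)
  have Sb: "S = (\<Sum>i<n. (cmod (b $ i))\<^sup>2)"
    using unitary_norm_preserving[OF V w] by (simp add: S_def b_def)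
  have Spos: "0 < S"
  proof -
    have "\<exists>i\<le>j. a $ i \<noteq> 0" using a(1,2) by (auto simp: vec_eq_iff less_Suc_eq_le)
    then obtain i where i: "i \<le> j" "a $ i \<noteq> 0" by blast
    then have "0 < (cmod (a' $ i))\<^sup>2" using j by (simp add: a'_def)
    also have "\<dots> \<le> S" unfolding Sa using i j by (intro member_le_sum) auto
    finally show ?thesis .
  qed
  have carr: "U * D x * mat_adjoint U \<in> carrier_mat n n" "V * D y * mat_adjoint V \<in> carrier_mat n n"
    using c by (simp_all add: D_def mult_carrier_square)
  \<comment> \<open>The chain runs through the two quadratic forms at \<open>w\<close>:
    \<open>a'\<close> lives on indices up to \<open>j\<close>, where \<open>x\<close> is at least
    \<open>x j\<close>, and \<open>b\<close> on indices from \<open>j\<close> on, where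
    \<open>y\<close> is at most \<open>y j\<close>.\<close>
  have "x j * S = (\<Sum>i<n. x j * (cmod (a' $ i))\<^sup>2)" by (simp add: Sa sum_distrib_left)
  also have "\<dots> \<le> (\<Sum>i<n. x i * (cmod (a' $ i))\<^sup>2)"
    using a'0 x j by (intro sum_mono) (metis lessThan_iff mult_right_mono norm_zero mult_zero_right
        power_zero_numeral order_refl zero_le_power2)
  also have "\<dots> = Re (((U * D x * mat_adjoint U) *\<^sub>v w) \<bullet>c w)"
    using diagonal_quadratic_form[OF U w, of x] by (simp add: Uw D_def)
  also have "\<dots> \<le> Re (((V * D y * mat_adjoint V) *\<^sub>v w) \<bullet>c w)"
  proof -
    have "0 \<le> Re (((V * D y * mat_adjoint V - U * D x * mat_adjoint U) *\<^sub>v w) \<bullet>c w)"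
      using psd w by (auto simp: psd_mat_def)
    also have "(V * D y * mat_adjoint V - U * D x * mat_adjoint U) *\<^sub>v w =
        (V * D y * mat_adjoint V) *\<^sub>v w - (U * D x * mat_adjoint U) *\<^sub>v w"
      by (rule minus_mult_distrib_mat_vec[OF carr(2,1) w])
    also have "\<dots> \<bullet>c w = ((V * D y * mat_adjoint V) *\<^sub>v w) \<bullet>c w - ((U * D x * mat_adjoint U) *\<^sub>v w) \<bullet>c w"
      by (rule minus_scalar_prod_distrib[of _ n]) (use carr w in auto)
    finally show ?thesis by simp
  qed
  also have "\<dots> = (\<Sum>i<n. y i * (cmod (b $ i))\<^sup>2)"
    using diagonal_quadratic_form[OF V w, of y] by (simp add: b_def D_def)
  also have "\<dots> \<le> (\<Sum>i<n. y j * (cmod (b $ i))\<^sup>2)"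
    using b0 y by (intro sum_mono) (metis lessThan_iff mult_right_mono norm_zero mult_zero_right
        power_zero_numeral order_refl zero_le_power2 not_le)
  also have "\<dots> = y j * S" by (simp add: Sb sum_distrib_left)
  finally show ?thesis using Spos by simp
qed

subsection \<open>Loewner domination up to unitary conjugation\<close>

lemma conjugation_conjugation:
  fixes U V H :: "complex mat"
  assumes "U \<in> carrier_mat n n" "V \<in> carrier_mat n n" "H \<in> carrier_mat n n"
  shows "U * (V * H * mat_adjoint V) * mat_adjoint U = (U * V) * H * mat_adjoint (U * V)"
  using assms
  by (simp add: mat_adjoint_mult mat_adjoint_carrier mult_carrier_square
      assoc_mult_mat[of _ n n _ n _ n])

lemma diagonal_conjugation_diff:
  fixes x y :: "nat \<Rightarrow> real"
  assumes U: "U \<in> carrier_mat n n"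
  shows "U * mat_diag n (\<lambda>i. complex_of_real (y i)) * mat_adjoint U -
      U * mat_diag n (\<lambda>i. complex_of_real (x i)) * mat_adjoint U =
    U * mat_diag n (\<lambda>i. complex_of_real (y i - x i)) * mat_adjoint U" (is "?L = ?R")
proof (rule eq_matI)
  fix i k assume "i < dim_row ?R" "k < dim_col ?R"
  then have ik: "i < n" "k < n" using U by auto
  have "?L $$ (i, k) = (\<Sum>j<n. U $$ (i, j) * complex_of_real (y j) * conjugate (U $$ (k, j))) -
      (\<Sum>j<n. U $$ (i, j) * complex_of_real (x j) * conjugate (U $$ (k, j)))"
    unfolding unitary_diagonal_index[OF U ik, symmetric] using ik U by (subst index_minus_mat) auto
  also have "\<dots> = ?R $$ (i, k)"
    unfolding unitary_diagonal_index[OF U ik] by (simp add: sum_subtractf[symmetric] algebra_simps)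
  finally show "?L $$ (i, k) = ?R $$ (i, k)" .
qed (use U in auto)

lemma unitary_loewner_iff_eigval:
  assumes X: "hermitian_mat n X" and Y: "hermitian_mat n Y"
  shows "(\<exists>U. unitary_mat n U \<and> loewner_le n (U * X * mat_adjoint U) Y) \<longleftrightarrow>
    (\<forall>j\<in>{1..n}. eigval j X \<le> eigval j Y)"
proof -
  let ?D = "\<lambda>z :: nat \<Rightarrow> real. mat_diag n (\<lambda>i. complex_of_real (z i))"
  have Xc: "X \<in> carrier_mat n n" and Yc: "Y \<in> carrier_mat n n"
    using X Y by (auto simp: hermitian_mat_def)
  obtain P x where Px: "unitary_diagonalization X P x" and x: "\<And>i j. i \<le> j \<Longrightarrow> j < n \<Longrightarrow> x j \<le> x i"
    using hermitian_sorted_diagonalization[OF X] by blast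
  obtain Q y where Qy: "unitary_diagonalization Y Q y" and y: "\<And>i j. i \<le> j \<Longrightarrow> j < n \<Longrightarrow> y j \<le> y i"
    using hermitian_sorted_diagonalization[OF Y] by blast
  have P: "unitary_mat n P" and Xeq: "X = P * ?D x * mat_adjoint P"
    using Px Xc by (auto simp: unitary_diagonalization_def)
  have Q: "unitary_mat n Q" and Yeq: "Y = Q * ?D y * mat_adjoint Q"
    using Qy Yc by (auto simp: unitary_diagonalization_def)
  note c = unitary_matD[OF P] unitary_matD[OF Q]
  have ev: "eigval j X = x (j - 1)" "eigval j Y = y (j - 1)" if "j \<in> {1..n}" for j
    using eigval_sorted_diagonalization[OF Xc Px x that] eigval_sorted_diagonalization[OF Yc Qy y that]
    by auto
  have conj: "U * X * mat_adjoint U = (U * P) * ?D x * mat_adjoint (U * P)"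
    if "U \<in> carrier_mat n n" for U
    unfolding Xeq by (rule conjugation_conjugation[OF that c(1) mat_diag_dim])
  show ?thesis
  proof
    assume "\<exists>U. unitary_mat n U \<and> loewner_le n (U * X * mat_adjoint U) Y"
    then obtain U where U: "unitary_mat n U" and "psd_mat n (Y - U * X * mat_adjoint U)"
      by (auto simp: loewner_le_def)
    \<comment> \<open>Conjugation by \<open>U\<close> keeps the ordered eigenvalues \<open>x\<close>
      and moves the eigenbasis from \<open>P\<close> to \<open>U * P\<close>.\<close>
    then have "psd_mat n (Q * ?D y * mat_adjoint Q - (U * P) * ?D x * mat_adjoint (U * P))"
      by (simp only: conj unitary_matD flip: Yeq)
    then have "x j \<le> y j" if "j < n" for j
      by (rule weyl_monotonicity[OF unitary_mat_mult[OF U P] Q]) (use that x y in auto)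
    then show "\<forall>j\<in>{1..n}. eigval j X \<le> eigval j Y" by (auto simp: ev)
  next
    assume le: "\<forall>j\<in>{1..n}. eigval j X \<le> eigval j Y"
    have xy: "0 \<le> y i - x i" if "i < n" for i
      using le[rule_format, of "Suc i"] ev[of "Suc i"] that by simp
    \<comment> \<open>This \<open>U\<close> maps the ordered eigenbasis of \<open>X\<close> to that
      of \<open>Y\<close>, so both matrices become diagonal in the basis \<open>Q\<close>.\<close>
    define U where "U = Q * mat_adjoint P"
    have U: "unitary_mat n U"
      unfolding U_def by (rule unitary_mat_mult[OF Q unitary_mat_adjoint[OF P]])
    have "U * P = Q"
      using c by (simp add: U_def assoc_mult_mat[of _ n n _ n _ n])
    then have UX: "U * X * mat_adjoint U = Q * ?D x * mat_adjoint Q"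
      using conj[OF unitary_matD(1)[OF U]] by simp
    have "Y - U * X * mat_adjoint U = Q * ?D (\<lambda>i. y i - x i) * mat_adjoint Q"
      unfolding UX Yeq by (rule diagonal_conjugation_diff[OF c(5)])
    then have "psd_mat n (Y - U * X * mat_adjoint U)"
      using psd_mat_diagonal_iff[OF Q, of "\<lambda>i. y i - x i"] xy by simp
    then have "loewner_le n (U * X * mat_adjoint U) Y"
      using Y hermitian_conjugation[OF X unitary_matD(1)[OF U]] by (simp add: loewner_le_def)
    then show "\<exists>U. unitary_mat n U \<and> loewner_le n (U * X * mat_adjoint U) Y"
      using U by blast
  qed
qed

text \<open>A real-valued \<open>f\<close> keeps the diagonal real, and unitary conjugation
  preserves Hermitian matrices.\<close>

lemma hermitian_mat_fun:
  assumes A: "hermitian_mat n A"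
  shows "hermitian_mat n (mat_fun f A)"
proof -
  obtain U d where Ud: "unitary_diagonalization A U d"
    using hermitian_diagonalizable[OF A] by blast
  have n: "dim_row A = n" using A by (auto simp: hermitian_mat_def)
  have "U \<in> carrier_mat n n"
    using Ud unitary_matD(1) by (auto simp: unitary_diagonalization_def n)
  then show ?thesis
    unfolding mat_fun_eq[OF Ud] n by (rule hermitian_conjugation[OF hermitian_mat_diag])
qed

lemma hermitian_mat_abs:
  assumes X: "X \<in> carrier_mat n n"
  shows "hermitian_mat n (mat_abs X)"
proof -
  have "hermitian_mat n (mat_adjoint X * X)"
    using X by (simp add: hermitian_mat_def mat_adjoint_mult mat_adjoint_carrier mult_carrier_square)
  then show ?thesis by (simp add: mat_abs_def psd_powr_def hermitian_mat_fun)
qed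

lemma ordered_prod_carrier:
  assumes "\<And>i. i \<in> {1..m} \<Longrightarrow> A i \<in> carrier_mat n n"
  shows "ordered_prod n m A \<in> carrier_mat n n"
proof -
  \<comment> \<open>The induction runs over arbitrary lists of admissible indices, since the tail of
    an index interval starting at 1 no longer starts there.\<close>
  have "foldr (*) (map A xs) (1\<^sub>m n) \<in> carrier_mat n n" if "set xs \<subseteq> {1..m}" for xs
    using that assms by (induction xs) (auto simp: mult_carrier_square)
  then show ?thesis by (simp add: ordered_prod_def subset_iff del: upt_Suc)
qed

lemma hermitian_young_sum:
  assumes "\<And>i. i \<in> {1..m} \<Longrightarrow> hermitian_mat n (A i)"
  shows "hermitian_mat n (young_sum n m p A)"
proof -
  define g where "g i = complex_of_real (1 / p i) \<cdot>\<^sub>m psd_powr (A i) (p i)" for i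
  have g: "hermitian_mat n (g i)" if "i \<in> {1..m}" for i
  proof -
    have "hermitian_mat n (psd_powr (A i) (p i))"
      using assms[OF that] by (simp add: psd_powr_def hermitian_mat_fun)
    moreover have "hermitian_mat n (complex_of_real c \<cdot>\<^sub>m B)" if "hermitian_mat n B" for c B
    proof -
      have "B \<in> carrier_mat n n" "mat_adjoint B = B" using that by (auto simp: hermitian_mat_def)
      moreover have "mat_adjoint (complex_of_real c \<cdot>\<^sub>m B) = complex_of_real c \<cdot>\<^sub>m mat_adjoint B"
        by (rule eq_matI) auto
      ultimately show ?thesis by (simp add: hermitian_mat_def)
    qed
    ultimately show ?thesis by (simp only: g_def)
  qed
  have "hermitian_mat n (foldr (+) (map g xs) (0\<^sub>m n n))" if "set xs \<subseteq> {1..m}" for xs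
    using that
  proof (induction xs)
    case Nil
    have "mat_adjoint (0\<^sub>m n n) = (0\<^sub>m n n :: complex mat)" by (rule eq_matI) auto
    then show ?case by (simp add: hermitian_mat_def)
  next
    case (Cons i xs)
    then show ?case using g[of i] by (simp add: hermitian_mat_def mat_adjoint_add[of _ n n])
  qed
  then show ?thesis by (simp add: young_sum_def g_def[abs_def] subset_iff del: upt_Suc)
qed

text \<open>Both matrices being compared are Hermitian, so \<open>unitary_loewner_iff_eigval\<close>
  applies.\<close>

lemma lin_unitary_iff_lin_eigenvalues:
  assumes "lin_data n m p A"
  shows "lin_unitary n m p A \<longleftrightarrow> lin_eigenvalues n m p A"
proof -
  have A: "hermitian_mat n (A i)" if "i \<in> {1..m}" for i
    using assms that by (auto simp: lin_data_def psd_mat_def)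
  then have "hermitian_mat n (mat_abs (ordered_prod n m A))"
    by (intro hermitian_mat_abs ordered_prod_carrier) (auto simp: hermitian_mat_def)
  from unitary_loewner_iff_eigval[OF this hermitian_young_sum[OF A]]
  show ?thesis by (simp add: lin_unitary_def lin_eigenvalues_def)
qed

subsection \<open>Real two-by-two matrices and plane projections\<close>

text \<open>Every matrix of the counterexample is real; the rules below reduce their algebra to real
  arithmetic on four entries.\<close>

definition mat2 :: "real \<Rightarrow> real \<Rightarrow> real \<Rightarrow> real \<Rightarrow> complex mat" where
  "mat2 a b c d = mat 2 2 (\<lambda>(i, j). complex_of_real
     (if i = 0 then if j = 0 then a else b else if j = 0 then c else d))"

lemma mat2_carrier [simp]: "mat2 a b c d \<in> carrier_mat 2 2"
  by (simp add: mat2_def)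

lemma mat2_dim [simp]: "dim_row (mat2 a b c d) = 2" "dim_col (mat2 a b c d) = 2"
  by (simp_all add: mat2_def)

lemma mat2_mult [simp]:
  "mat2 a b c d * mat2 a' b' c' d' =
    mat2 (a * a' + b * c') (a * b' + b * d') (c * a' + d * c') (c * b' + d * d')"
  by (rule eq_matI) (auto simp: mat2_def scalar_prod_def numeral_2_eq_2 less_Suc_eq)

lemma mat2_add [simp]:
  "mat2 a b c d + mat2 a' b' c' d' = mat2 (a + a') (b + b') (c + c') (d + d')"
  by (rule eq_matI) (auto simp: mat2_def)

lemma mat2_smult [simp]:
  "complex_of_real k \<cdot>\<^sub>m mat2 a b c d = mat2 (k * a) (k * b) (k * c) (k * d)"
  by (rule eq_matI) (auto simp: mat2_def)

lemma mat2_adjoint [simp]: "mat_adjoint (mat2 a b c d) = mat2 a c b d"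
  by (rule eq_matI) (auto simp: mat2_def)

lemma mat2_one: "1\<^sub>m 2 = mat2 1 0 0 1"
  by (rule eq_matI) (auto simp: mat2_def)

lemma mat2_zero: "0\<^sub>m 2 2 = mat2 0 0 0 0"
  by (rule eq_matI) (auto simp: mat2_def)

lemma mat2_diag: "mat_diag 2 (\<lambda>i. complex_of_real (d i)) = mat2 (d 0) 0 0 (d 1)"
  by (rule eq_matI) (auto simp: mat2_def mat_diag_def less_2_cases_iff)

lemma unitary_rotation:
  assumes "a\<^sup>2 + b\<^sup>2 = 1"
  shows "unitary_mat 2 (mat2 a (- b) b a)"
  by (rule unitary_matI) (use assms in \<open>simp_all add: mat2_one power2_eq_square algebra_simps\<close>)

text \<open>The matrix is \<open>x\<close> times the projection onto the line of
  \<open>(a, b)\<close> plus \<open>y\<close> times the projection onto the line of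
  \<open>(-b, a)\<close>.\<close>

lemma rotation_diagonalization:
  assumes "a\<^sup>2 + b\<^sup>2 = 1"
  shows "unitary_diagonalization
    (mat2 (x * a\<^sup>2 + y * b\<^sup>2) ((x - y) * (a * b)) ((x - y) * (a * b)) (x * b\<^sup>2 + y * a\<^sup>2))
    (mat2 a (- b) b a) (\<lambda>i. if i = 0 then x else y)"
  using unitary_rotation[OF assms]
  by (simp add: unitary_diagonalization_def mat2_diag power2_eq_square algebra_simps)

lemma eigval_1_diagonalization:
  assumes "A \<in> carrier_mat 2 2" "unitary_diagonalization A U (\<lambda>i. if i = 0 then x else y)" "y \<le> x"
  shows "eigval 1 A = x"
  using eigval_sorted_diagonalization[OF assms(1,2), of 1] assms(3) by auto

text \<open>For \<open>(a, b)\<close> of norm 1 this is the orthogonal projection onto the line that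
  it spans.\<close>

definition proj2 :: "real \<Rightarrow> real \<Rightarrow> complex mat" where
  "proj2 a b = mat2 (a\<^sup>2) (a * b) (a * b) (b\<^sup>2)"

lemma proj2_diagonalization:
  assumes "a\<^sup>2 + b\<^sup>2 = 1"
  shows "unitary_diagonalization (proj2 a b) (mat2 a (- b) b a) (\<lambda>i. if i = 0 then 1 else 0)"
  using rotation_diagonalization[OF assms, of 1 0] by (simp add: proj2_def)

lemma psd_proj2:
  assumes "a\<^sup>2 + b\<^sup>2 = 1"
  shows "psd_mat 2 (proj2 a b)"
  using proj2_diagonalization[OF assms]
    psd_mat_diagonal_iff[OF unitary_rotation[OF assms], of "\<lambda>i. if i = 0 then 1 else 0"]
  by (simp add: unitary_diagonalization_def proj2_def del: mat2_mult)

text \<open>The eigenvalues 1 and 0 are fixed by \<open>powr p\<close>, because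
  \<open>0 powr p = 0\<close>.\<close>

lemma psd_powr_proj2:
  assumes "a\<^sup>2 + b\<^sup>2 = 1"
  shows "psd_powr (proj2 a b) p = proj2 a b"
proof -
  note D = proj2_diagonalization[OF assms]
  have "(\<lambda>i :: nat. complex_of_real ((if i = 0 then 1 else 0) powr p)) =
      (\<lambda>i. complex_of_real (if i = 0 then 1 else 0))"
    by auto
  then show ?thesis
    using D unfolding psd_powr_def mat_fun_eq[OF D] unfolding unitary_diagonalization_def by metis
qed

lemma foldr_mult_replicate_idempotent:
  fixes P :: "'a :: semiring_1 mat"
  assumes "P \<in> carrier_mat n n" "P * P = P"
  shows "foldr (*) (replicate (Suc k) P) (1\<^sub>m n) = P"
  using assms by (induction k) auto

lemma foldr_add_replicate_mat2:
  "foldr (+) (replicate k (mat2 a b c d)) (0\<^sub>m 2 2) =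
    mat2 (real k * a) (real k * b) (real k * c) (real k * d)"
  by (induction k) (auto simp: mat2_zero algebra_simps)

subsection \<open>The counterexample\<close>

text \<open>The last projection is repeated, sharing the weight \<open>7/16\<close> equally among its \<open>m - 3\<close> copies.\<close>

definition lin_factor :: "nat \<Rightarrow> complex mat" where
  "lin_factor i = (if i = 1 then proj2 1 0 else if i = 2 then proj2 (4/5) (3/5)
     else if i = 3 then proj2 (3/5) (4/5) else proj2 0 1)"

text \<open>The exponents are the reciprocals of the chosen weights.\<close>

definition lin_exponent :: "nat \<Rightarrow> nat \<Rightarrow> real" where
  "lin_exponent m i = (if i = 1 then 16/7 else if i = 2 \<or> i = 3 then 16 else 16 * real (m - 3) / 7)"

lemma psd_lin_factor: "psd_mat 2 (lin_factor i)"
  unfolding lin_factor_def by (auto intro!: psd_proj2 simp: power2_eq_square)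

lemma psd_powr_lin_factor: "psd_powr (lin_factor i) p = lin_factor i"
  unfolding lin_factor_def by (auto intro!: psd_powr_proj2 simp: power2_eq_square)

lemma upt_ge_4: "m \<ge> 4 \<Longrightarrow> [1..<Suc m] = [1, 2, 3] @ [4..<Suc m]"
  by (simp add: upt_conv_Cons numeral_eq_Suc del: upt_Suc)

text \<open>The inner products of consecutive unit vectors are \<open>4/5\<close>,
  \<open>24/25\<close> and \<open>4/5\<close>, with product \<open>384/625\<close>; the outer
  vectors \<open>(1, 0)\<close> and \<open>(0, 1)\<close> place it in the upper right entry.\<close>

lemma ordered_prod_lin_factor:
  assumes "m \<ge> 4"
  shows "ordered_prod 2 m lin_factor = mat2 0 (384/625) 0 0"
proof -
  \<comment> \<open>The \<open>m - 3\<close> copies are counted as \<open>Suc (m - 4)\<close> to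
    show that there is at least one, so they collapse to a single projection.\<close>
  have "map lin_factor [4..<Suc m] = replicate (Suc (m - 4)) (proj2 0 1)"
    using assms by (intro replicate_eqI) (auto simp: lin_factor_def)
  moreover have "foldr (*) (replicate (Suc (m - 4)) (proj2 0 1)) (1\<^sub>m 2) = proj2 0 1"
    by (rule foldr_mult_replicate_idempotent) (simp_all add: proj2_def)
  ultimately have "ordered_prod 2 m lin_factor =
      lin_factor 1 * (lin_factor 2 * (lin_factor 3 * proj2 0 1))"
    unfolding ordered_prod_def upt_ge_4[OF assms] by (simp del: upt_Suc replicate_Suc)
  then show ?thesis by (simp add: lin_factor_def proj2_def power2_eq_square)
qed

lemma eigval_mat_abs_lin_factor:
  assumes "m \<ge> 4"
  shows "eigval 1 (mat_abs (ordered_prod 2 m lin_factor)) = 384/625"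
proof -
  \<comment> \<open>The first column of the rotation \<open>?U\<close> is \<open>(0, 1)\<close>,
    which lists the nonzero eigenvalue first.\<close>
  let ?X = "mat2 0 (384/625) 0 0" and ?U = "mat2 0 (- 1) 1 0"
  have D: "unitary_diagonalization (mat_adjoint ?X * ?X) ?U (\<lambda>i. if i = 0 then (384/625)\<^sup>2 else 0)"
    using rotation_diagonalization[of 0 1 "(384/625)\<^sup>2" 0] by (simp add: power2_eq_square)
  have p: "(if i = 0 then (384/625)\<^sup>2 else 0) powr (1/2) = (if i = 0 then 384/625 else (0 :: real))" for i :: nat
    by (simp only: powr_half_sqrt real_sqrt_abs split: if_split) simp
  have "mat_abs ?X = ?U * mat_diag 2 (\<lambda>i. complex_of_real (if i = 0 then 384/625 else 0)) * mat_adjoint ?U"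
    unfolding mat_abs_def psd_powr_def mat_fun_eq[OF D] p by simp
  then have "mat_abs ?X \<in> carrier_mat 2 2"
    and "unitary_diagonalization (mat_abs ?X) ?U (\<lambda>i. if i = 0 then 384/625 else 0)"
    using unitary_rotation[of 0 1] by (simp_all add: unitary_diagonalization_def mat2_diag)
  then have "eigval 1 (mat_abs ?X) = 384/625" by (rule eigval_1_diagonalization) simp
  then show ?thesis by (simp add: ordered_prod_lin_factor[OF assms])
qed

text \<open>The weighted sum has diagonal entries \<open>1/2\<close> and off-diagonal entries
  \<open>3/50\<close>, hence eigenvalues \<open>1/2 + 3/50\<close> and
  \<open>1/2 - 3/50\<close>.\<close>

lemma eigval_young_sum_lin_factor:
  assumes "m \<ge> 4"
  shows "eigval 1 (young_sum 2 m (lin_exponent m) lin_factor) = 14/25"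
proof -
  let ?g = "\<lambda>i. complex_of_real (1 / lin_exponent m i) \<cdot>\<^sub>m lin_factor i"
  have "map ?g [4..<Suc m] = replicate (m - 3) (mat2 0 0 0 (7 / (16 * real (m - 3))))"
    using assms by (intro replicate_eqI) (auto simp: lin_factor_def lin_exponent_def proj2_def simp del: of_real_divide)
  moreover have weight: "real (m - 3) * (7 / (16 * real (m - 3))) = 7/16"
  proof -
    have "r * (7 / (16 * r)) = 7/16" if "r \<noteq> 0" for r :: real using that by simp
    moreover have "m - 3 \<noteq> 0" using assms by simp
    ultimately show ?thesis by (metis of_nat_eq_0_iff)
  qed
  ultimately have "foldr (+) (map ?g [4..<Suc m]) (0\<^sub>m 2 2) = mat2 0 0 0 (7/16)"
    by (simp only: foldr_add_replicate_mat2 weight mult_zero_right)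
  then have "young_sum 2 m (lin_exponent m) lin_factor =
      ?g 1 + (?g 2 + (?g 3 + mat2 0 0 0 (7/16)))"
    unfolding young_sum_def upt_ge_4[OF assms] psd_powr_lin_factor by (simp del: upt_Suc of_real_divide)
  also have "\<dots> = mat2 (1/2) (3/50) (3/50) (1/2)"
    by (simp add: lin_factor_def lin_exponent_def proj2_def power2_eq_square del: of_real_divide)
  finally have S: "young_sum 2 m (lin_exponent m) lin_factor = mat2 (1/2) (3/50) (3/50) (1/2)" .
  \<comment> \<open>Equal diagonal entries make \<open>(1, 1)\<close> and \<open>(-1, 1)\<close>
    eigenvectors, so the rotation is by 45 degrees.\<close>
  have "unitary_diagonalization (mat2 (1/2) (3/50) (3/50) (1/2))
      (mat2 (sqrt (1/2)) (- sqrt (1/2)) (sqrt (1/2)) (sqrt (1/2))) (\<lambda>i. if i = 0 then 14/25 else 11/25)"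
    using rotation_diagonalization[of "sqrt (1/2)" "sqrt (1/2)" "14/25" "11/25"]
    by (simp del: real_sqrt_divide real_sqrt_one add: real_sqrt_mult[symmetric])
  then show ?thesis unfolding S by (intro eigval_1_diagonalization) auto
qed

lemma sum_inverse_lin_exponent:
  assumes "m \<ge> 4"
  shows "(\<Sum>i = 1..m. 1 / lin_exponent m i) = 1"
proof -
  \<comment> \<open>Here \<open>k\<close> is the number of copies of the last projection.\<close>
  obtain k where k: "m = 3 + k" "k \<ge> 1" using assms nat_le_iff_add[of 4 m] by force
  have "(\<Sum>i = 1..3 + k. 1 / lin_exponent m i) =
      (\<Sum>i = 1..3. 1 / lin_exponent m i) + (\<Sum>i = 3 + 1..3 + k. 1 / lin_exponent m i)"
    by (rule sum.ub_add_nat) simp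
  also have "(\<Sum>i = 3 + 1..3 + k. 1 / lin_exponent m i) = (\<Sum>i = 3 + 1..3 + k. 7 / (16 * real k))"
    by (intro sum.cong) (auto simp: lin_exponent_def k)
  also have "\<dots> = 7/16" using k by simp
  also have "(\<Sum>i = 1..3. 1 / lin_exponent m i) = 9/16"
    by (simp add: lin_exponent_def numeral_eq_Suc)
  finally show ?thesis by (simp add: k)
qed

text \<open>Since \<open>m - 3\<close> is at least 1, no exponent is below
  \<open>16/7\<close>.\<close>

lemma lin_exponent_gt_1: "m \<ge> 4 \<Longrightarrow> 1 < lin_exponent m i"
  by (auto simp: lin_exponent_def)

theorem theorem1:
  fixes m :: nat
  assumes "m \<ge> 4"
  shows "\<not> lin_conjecture m \<and>
    (\<forall>n\<ge>1. \<forall>p A. lin_data n m p A \<longrightarrow> (lin_unitary n m p A \<longleftrightarrow> lin_eigenvalues n m p A)) \<and>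
    (\<exists>(p :: nat \<Rightarrow> real) (A :: nat \<Rightarrow> complex mat).
       (\<forall>i\<in>{1..m}. psd_mat 2 (A i)) \<and> (\<forall>i\<in>{1..m}. 1 < p i) \<and> (\<Sum>i=1..m. 1 / p i) = 1 \<and>
       eigval 1 (mat_abs (ordered_prod 2 m A)) > eigval 1 (young_sum 2 m p A))"
proof (intro conjI)
  let ?p = "lin_exponent m"
  have gt: "eigval 1 (mat_abs (ordered_prod 2 m lin_factor)) > eigval 1 (young_sum 2 m ?p lin_factor)"
    by (simp only: eigval_mat_abs_lin_factor[OF assms] eigval_young_sum_lin_factor[OF assms])
  have p1: "1 < ?p i" for i by (rule lin_exponent_gt_1[OF assms])
  have "0 < ?p i" for i using p1[of i] by simp
  then have "lin_data 2 m ?p lin_factor"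
    using psd_lin_factor sum_inverse_lin_exponent[OF assms]
    by (simp add: lin_data_def)
  \<comment> \<open>The eigenvalue form fails at \<open>j = 1\<close>, and the equivalence transfers
    this to the unitary form.\<close>
  moreover from this have "\<not> lin_unitary 2 m ?p lin_factor"
    using gt by (auto simp: lin_unitary_iff_lin_eigenvalues lin_eigenvalues_def not_le)
  ultimately show "\<not> lin_conjecture m" unfolding lin_conjecture_def by (meson one_le_numeral)
  show "\<exists>p A. (\<forall>i\<in>{1..m}. psd_mat 2 (A i)) \<and> (\<forall>i\<in>{1..m}. 1 < p i) \<and> (\<Sum>i=1..m. 1 / p i) = 1 \<and>
       eigval 1 (mat_abs (ordered_prod 2 m A)) > eigval 1 (young_sum 2 m p A)"
    using psd_lin_factor p1 sum_inverse_lin_exponent[OF assms] gt by blast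
qed (use lin_unitary_iff_lin_eigenvalues in blast)

end
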